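(* Let $f\colon\mathbf{R}^2\to\mathbf{R}$ be an asymptotically constant $C^2$ function. Then for every direction $X(\theta_0)\in\mathbf{S}^1$, $$\lim_{r\to\infty}\int_{p\in B_r}\frac{\partial k}{\partial\theta}\big(p,X(\theta_0)\big)\left(1+f_{X(\theta_0)}^2(p)\right)\,d\mathcal{A}_p=0.$$ In particular, the set of points $p\in\mathbf{R}^2$ where $X(\theta_0)$ is a principal direction of $f$ at $p$ is either all of $\mathbf{R}^2$ or else separates $\mathbf{R}^2$.
   Context: A function $f\colon\mathbf{R}^2\to\mathbf{R}$ is asymptotically constant if, in polar coordinates $(r,\theta)$, $$\lim_{r\to\infty}f(r,\theta)=\text{const.}\quad\text{and}\quad\lim_{r\to\infty}r\,\|\nabla f(r,\theta)\|=0,$$ both uniformly with respect to $\theta$ (the constant does not depend on $\theta$). $\mathbf{S}^1\subset\mathbf{R}^2$ is the unit circle, whose elements are called directions, and $X(\theta):=(\cos\theta,\sin\theta)$. For $X\in\mathbf{S}^1$, $f_X:=\langle\nabla f,X\rangle$ is the derivative of $f$ in the direction $X$, $f_{XX}:=(f_X)_X$, and $f_X^2$ denotes $(f_X)^2$. For $p\in\mathbf{R}^2$ and $X\in\mathbf{S}^1$, $$k(p,X):=\frac{f_{XX}(p)}{\left(1+f_X^2(p)\right)\sqrt{1+\|\nabla f(p)\|^2}},$$ which is the normal curvature of the graph of $f$ at $(p,f(p))$ in the direction of a tangent vector whose projection into $\mathbf{R}^2$ is parallel to $X$. The quantity $\frac{\partial k}{\partial\theta}(p,X(\theta_0))$ is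 the derivative at $\theta=\theta_0$ of the function $\theta\mapsto k(p,X(\theta))$. A direction $X\in\mathbf{S}^1$ is a principal direction of $f$ at $p\in\mathbf{R}^2$ if $X$ is parallel to the projection into $\mathbf{R}^2$ of a principal direction of $\operatorname{graph}(f)$ at $(p,f(p))$ (at an umbilic, i.e., a point where the principal curvatures are equal, every tangent direction is principal). Equivalently, $X(\theta_0)$ is a principal direction of $f$ at $p$ if and only if $\theta_0$ is a critical point of $\theta\mapsto k(p,X(\theta))$. $B_r$ is the closed ball of radius $r$ centered at the origin of $\mathbf{R}^2$, and $d\mathcal{A}_p:=\sqrt{1+\|\nabla f(p)\|^2}\,dx\wedge dy$ is the area element of the graph of $f$. A subset of $\mathbf{R}^2$ separates $\mathbf{R}^2$ if its complement in $\mathbf{R}^2$ is disconnected. *)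

theory Defs
  imports "HOL-Analysis.Analysis"
begin

definition unit_dir :: "real \<Rightarrow> real^2" where
  "unit_dir \<theta> = vector [cos \<theta>, sin \<theta>]"

text \<open>The gradient is the vector \<open>D\<close> with \<open>GDERIV f p :> D\<close>; it is unspecified where \<open>f\<close> is not
  differentiable.\<close>

definition grad :: "('a::real_inner \<Rightarrow> real) \<Rightarrow> 'a \<Rightarrow> 'a" where
  "grad f p = (THE D. GDERIV f p :> D)"

text \<open>Twice Frechet differentiable everywhere with continuous second derivative.\<close>

definition C2 :: "('a::real_normed_vector \<Rightarrow> 'b::real_normed_vector) \<Rightarrow> bool" where
  "C2 f \<longleftrightarrow> (\<exists>(f' :: 'a \<Rightarrow> 'a \<Rightarrow>\<^sub>L 'b) (f'' :: 'a \<Rightarrow> 'a \<Rightarrow>\<^sub>L 'a \<Rightarrow>\<^sub>L 'b).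
     (\<forall>p. (f has_derivative blinfun_apply (f' p)) (at p)) \<and>
     (\<forall>p. (f' has_derivative blinfun_apply (f'' p)) (at p)) \<and>
     continuous_on UNIV f'')"

definition asymptotically_constant :: "(real^2 \<Rightarrow> real) \<Rightarrow> bool" where
  "asymptotically_constant f \<longleftrightarrow>
     (\<exists>c. uniform_limit UNIV (\<lambda>r \<theta>. f (r *\<^sub>R unit_dir \<theta>)) (\<lambda>_. c) at_top) \<and>
     uniform_limit UNIV (\<lambda>r \<theta>. r * norm (grad f (r *\<^sub>R unit_dir \<theta>))) (\<lambda>_. 0) at_top"

definition dir_deriv :: "('a::real_inner \<Rightarrow> real) \<Rightarrow> 'a \<Rightarrow> 'a \<Rightarrow> real" where
  "dir_deriv f X p = grad f p \<bullet> X"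

definition area_density :: "(real^2 \<Rightarrow> real) \<Rightarrow> real^2 \<Rightarrow> real" where
  "area_density f p = sqrt (1 + (norm (grad f p))\<^sup>2)"

definition normal_curvature :: "(real^2 \<Rightarrow> real) \<Rightarrow> real^2 \<Rightarrow> real^2 \<Rightarrow> real" where
  "normal_curvature f p X =
     dir_deriv (dir_deriv f X) X p / ((1 + (dir_deriv f X p)\<^sup>2) * area_density f p)"

definition normal_curvature_deriv :: "(real^2 \<Rightarrow> real) \<Rightarrow> real^2 \<Rightarrow> real \<Rightarrow> real" where
  "normal_curvature_deriv f p \<theta>\<^sub>0 = deriv (\<lambda>\<theta>. normal_curvature f p (unit_dir \<theta>)) \<theta>\<^sub>0"

text \<open>The graph of \<open>f\<close> is the surface of points \<open>(p, f p)\<close> in \<open>\<real>\<^sup>2 \<times> \<real>\<close>, parametrised by \<open>p\<close>; its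
  unit normal field is regarded as a function of \<open>p\<close>.\<close>

definition graph_tangent_space :: "(real^2 \<Rightarrow> real) \<Rightarrow> real^2 \<Rightarrow> ((real^2) \<times> real) set" where
  "graph_tangent_space f p = range (\<lambda>u. (u, dir_deriv f u p))"

definition graph_normal :: "(real^2 \<Rightarrow> real) \<Rightarrow> real^2 \<Rightarrow> (real^2) \<times> real" where
  "graph_normal f p = (1 / area_density f p) *\<^sub>R (- grad f p, 1)"

text \<open>The shape operator is minus the derivative of the unit normal along the surface. The tangent
  vector \<open>v\<close> at \<open>(p, f p)\<close> is the velocity of the lift to the graph of \<open>t \<mapsto> p + t *\<^sub>R fst v\<close>, so in
  the parametrisation by \<open>p\<close> the normal is differentiated in direction \<open>fst v\<close>.\<close>

definition shape_operator :: "(real^2 \<Rightarrow> real) \<Rightarrow> real^2 \<Rightarrow> (real^2) \<times> real \<Rightarrow> (real^2) \<times> real" where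
  "shape_operator f p v = - frechet_derivative (graph_normal f) (at p) (fst v)"

text \<open>Principal directions are the eigenvectors of the shape operator, so at an umbilic every nonzero
  tangent vector is principal.\<close>

definition graph_principal_direction :: "(real^2 \<Rightarrow> real) \<Rightarrow> real^2 \<Rightarrow> (real^2) \<times> real \<Rightarrow> bool" where
  "graph_principal_direction f p v \<longleftrightarrow>
     v \<in> graph_tangent_space f p \<and> v \<noteq> 0 \<and> (\<exists>\<kappa>. shape_operator f p v = \<kappa> *\<^sub>R v)"

definition principal_direction :: "(real^2 \<Rightarrow> real) \<Rightarrow> real^2 \<Rightarrow> real^2 \<Rightarrow> bool" where
  "principal_direction f p X \<longleftrightarrow>
     (\<exists>v. graph_principal_direction f p v \<and> (\<exists>c. c \<noteq> 0 \<and> X = c *\<^sub>R fst v))"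

definition separates :: "'a::topological_space set \<Rightarrow> bool" where
  "separates S \<longleftrightarrow> \<not> connected (- S)"

end

theory Submission
  imports Defs
begin

text \<open>Let \<open>X\<close> be the direction of angle \<open>\<theta>\<^sub>0\<close> and \<open>Y\<close> its rotation by a right angle. Differentiating the
  normal curvature and multiplying by \<open>(1 + f\<^sub>X\<^sup>2)\<close> and by the area density gives
  \<open>2 f\<^sub>X\<^sub>Y - 2 f\<^sub>X\<^sub>X f\<^sub>X f\<^sub>Y / (1 + f\<^sub>X\<^sup>2)\<close>,
  called the principal defect below (\<open>curvature_integrand_eq_principal_defect\<close>). Two facts about
  this expression carry the theorem.

  It is a divergence: it equals \<open>D\<^sub>X P + D\<^sub>Y Q\<close> with \<open>P = - f\<^sub>Y ln (1 + f\<^sub>X\<^sup>2)\<close> and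
  \<open>Q = f\<^sub>X ln (1 + f\<^sub>X\<^sup>2) + 2 arctan f\<^sub>X\<close> (\<open>principal_defect_eq_divergence\<close>). Where the gradient is small,
  \<open>P\<close> and \<open>Q\<close> are bounded by a multiple of its norm, which on the circle of radius \<open>r\<close> is of order
  smaller than \<open>1 / r\<close>. By integration along chords, the integral over the disc of a directional derivative of a function
  is in absolute value at most a constant times \<open>r\<close> times the maximum of the modulus of that function on the circle
  (\<open>integral_directional_derivative_disc_bound\<close>). Hence the integrals tend to \<open>0\<close>.

  It is continuous and vanishes exactly where \<open>X\<close> is a principal direction (\<open>principal_direction_iff\<close>). If
  its zero set did not separate the plane and were not the whole plane, then it would have constant sign on
  the connected nonempty complement, and its integrals over large discs would stay away from \<open>0\<close>
  (\<open>lim_disc_integrals_zero_imp_zero_set_separates\<close>).\<close>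

section \<open>Symmetry of second derivatives\<close>

text \<open>Both values are the limit of the same second difference quotient
  \<open>(f (p + h u + h v) - f (p + h u) - f (p + h v) + f p) / h\<^sup>2\<close>: two applications of the mean value
  theorem turn it into a value of \<open>f''\<close> near \<open>p\<close>, and the order in which the directions are
  treated decides the order of the arguments.\<close>

lemma second_derivative_symmetric:
  fixes f :: "'a::real_normed_vector \<Rightarrow> real"
  assumes f': "\<And>p. (f has_derivative blinfun_apply (f' p)) (at p)"
    and f'': "\<And>p. (f' has_derivative blinfun_apply (f'' p)) (at p)"
    and cont: "continuous_on UNIV f''"
  shows "blinfun_apply (blinfun_apply (f'' p) u) v = blinfun_apply (blinfun_apply (f'' p) v) u"
proof -
  define D where "D u v h = f (p + h *\<^sub>R u + h *\<^sub>R v) - f (p + h *\<^sub>R u) - f (p + h *\<^sub>R v) + f p"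
    for u v :: 'a and h :: real
  have D_sym: "D u v h = D v u h" for u v h
    by (simp add: D_def add_ac)
  have D_mvt: "\<exists>a b. 0 < a \<and> a < h \<and> 0 < b \<and> b < h \<and>
      D u v h = h * h * blinfun_apply (blinfun_apply (f'' (p + a *\<^sub>R u + b *\<^sub>R v)) v) u"
    if "0 < h" for u v h
  proof -
    have d1: "((\<lambda>t. f (p + t *\<^sub>R u + w)) has_real_derivative blinfun_apply (f' (p + t *\<^sub>R u + w)) u) (at t)"
      for t w
    proof -
      have "((\<lambda>t. p + t *\<^sub>R u + w) has_derivative (\<lambda>t. t *\<^sub>R u)) (at t)"
        by (auto intro!: derivative_eq_intros)
      from has_derivative_compose[OF this f'] show ?thesis
        by (simp add: has_field_derivative_def blinfun.scaleR_right mult_commute_abs)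
    qed
    have d2: "((\<lambda>t. blinfun_apply (f' (q + t *\<^sub>R v)) u) has_real_derivative
        blinfun_apply (blinfun_apply (f'' (q + t *\<^sub>R v)) v) u) (at t)" for t q
    proof -
      have "((\<lambda>t. q + t *\<^sub>R v) has_derivative (\<lambda>t. t *\<^sub>R v)) (at t)"
        by (auto intro!: derivative_eq_intros)
      note has_derivative_compose[OF has_derivative_compose[OF this f'']
          bounded_linear_imp_has_derivative[OF blinfun.bounded_linear_left]]
      from this[of u]
      show ?thesis
        by (simp add: has_field_derivative_def blinfun.scaleR_right blinfun.scaleR_left mult_commute_abs)
    qed
    have "((\<lambda>t. f (p + t *\<^sub>R u + h *\<^sub>R v) - f (p + t *\<^sub>R u)) has_real_derivative
      blinfun_apply (f' (p + t *\<^sub>R u + h *\<^sub>R v)) u - blinfun_apply (f' (p + t *\<^sub>R u)) u) (at t)" for t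
      using DERIV_diff[OF d1[of "h *\<^sub>R v" t] d1[of 0 t]] by simp
    from MVT2[OF \<open>0 < h\<close> this] obtain a where a: "0 < a" "a < h"
      and Da: "D u v h = h * (blinfun_apply (f' (p + a *\<^sub>R u + h *\<^sub>R v)) u - blinfun_apply (f' (p + a *\<^sub>R u)) u)"
      by (auto simp: D_def algebra_simps)
    from MVT2[OF \<open>0 < h\<close> d2[of "p + a *\<^sub>R u"]] obtain b where "0 < b" "b < h"
      "blinfun_apply (f' (p + a *\<^sub>R u + h *\<^sub>R v)) u - blinfun_apply (f' (p + a *\<^sub>R u)) u
        = h * blinfun_apply (blinfun_apply (f'' (p + a *\<^sub>R u + b *\<^sub>R v)) v) u"
      by auto
    with a Da show ?thesis by (intro exI[of _ a] exI[of _ b]) simp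
  qed
  have lim: "((\<lambda>h. D u v h / (h * h)) \<longlongrightarrow> blinfun_apply (blinfun_apply (f'' p) v) u) (at_right 0)" for u v
  proof -
    obtain a b where ab: "\<And>h. 0 < h \<Longrightarrow> 0 < a h \<and> a h < h \<and> 0 < b h \<and> b h < h \<and>
        D u v h = h * h * blinfun_apply (blinfun_apply (f'' (p + a h *\<^sub>R u + b h *\<^sub>R v)) v) u"
      using D_mvt[of _ u v] by metis
    have small: "(c \<longlongrightarrow> 0) (at_right 0)" if "\<And>h. 0 < h \<Longrightarrow> 0 < c h \<and> c h < h" for c :: "real \<Rightarrow> real"
    proof (rule tendsto_sandwich[where f="\<lambda>_. 0" and h="\<lambda>h. h"])
      show "\<forall>\<^sub>F h in at_right 0. 0 \<le> c h" "\<forall>\<^sub>F h in at_right 0. c h \<le> h"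
        using that by (auto simp: eventually_at_filter less_imp_le)
    qed (auto intro: tendsto_eq_intros)
    have "((\<lambda>h. p + a h *\<^sub>R u + b h *\<^sub>R v) \<longlongrightarrow> p + 0 *\<^sub>R u + 0 *\<^sub>R v) (at_right 0)"
      using ab by (intro tendsto_intros small) auto
    then have "((\<lambda>h. p + a h *\<^sub>R u + b h *\<^sub>R v) \<longlongrightarrow> p) (at_right 0)"
      by simp
    moreover have "isCont f'' p"
      using cont by (simp add: continuous_on_eq_continuous_at)
    ultimately have "((\<lambda>h. f'' (p + a h *\<^sub>R u + b h *\<^sub>R v)) \<longlongrightarrow> f'' p) (at_right 0)"
      by (rule isCont_tendsto_compose[rotated])
    then have "((\<lambda>h. blinfun_apply (blinfun_apply (f'' (p + a h *\<^sub>R u + b h *\<^sub>R v)) v) u)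
        \<longlongrightarrow> blinfun_apply (blinfun_apply (f'' p) v) u) (at_right 0)"
      by (intro tendsto_intros)
    then show ?thesis
      by (rule Lim_transform_eventually) (auto simp: eventually_at_filter ab)
  qed
  have "((\<lambda>h. D u v h / (h * h)) \<longlongrightarrow> blinfun_apply (blinfun_apply (f'' p) u) v) (at_right 0)"
    using lim[of v u] by (simp add: D_sym[of v u])
  from tendsto_unique[OF _ this lim] show ?thesis by simp
qed

section \<open>Integrals over discs\<close>

text \<open>Fubini's theorem is stated for product measures. This lemma carries integrals over \<open>\<real>\<^sup>2\<close> as a
  vector space over to \<open>\<real> \<times> \<real>\<close>; either coordinate may be made the inner variable.\<close>

lemma lborel_vec2_eq_distr:
  fixes i j :: 2
  assumes "i \<noteq> j"
  shows "(lborel :: (real^2) measure) =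
    distr (lborel :: (real \<times> real) measure) borel (\<lambda>(y, x). y *\<^sub>R axis j 1 + x *\<^sub>R axis i 1)"
proof (rule lborel_eqI)
  let ?\<Phi> = "\<lambda>(y, x). y *\<^sub>R axis j 1 + x *\<^sub>R axis i 1 :: real^2"
  have UNIV_ij: "(UNIV :: 2 set) = {i, j}"
    using assms exhaust_2[of i] exhaust_2[of j] by (auto simp: UNIV_2)
  have meas: "?\<Phi> \<in> borel_measurable lborel"
    unfolding case_prod_beta measurable_lborel2
    by (intro borel_measurable_continuous_onI continuous_intros)
  have ij: "axis i (1 :: real) $ j = 0" "axis j (1 :: real) $ i = 0"
    using assms by (auto simp: axis_def)
  fix l u :: "real^2"
  assume le: "\<And>b. b \<in> Basis \<Longrightarrow> l \<bullet> b \<le> u \<bullet> b"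
  have "?\<Phi> -` box l u = box (l $ j, l $ i) (u $ j, u $ i)"
    using ij by (auto simp: box_def Basis_vec_def UNIV_ij Basis_prod_def inner_axis)
  moreover have "\<forall>b\<in>Basis. (l $ j, l $ i) \<bullet> b \<le> (u $ j, u $ i) \<bullet> b"
    using le[of "axis i 1"] le[of "axis j 1"] by (auto simp: Basis_prod_def inner_axis)
  ultimately have "emeasure (distr lborel borel ?\<Phi>) (box l u) =
      (\<Prod>b\<in>Basis. ((u $ j, u $ i) - (l $ j, l $ i)) \<bullet> b)"
    using meas by (simp add: emeasure_distr emeasure_lborel_box_eq)
  also have "(\<Prod>b\<in>Basis. ((u $ j, u $ i) - (l $ j, l $ i)) \<bullet> b) = (u $ j - l $ j) * (u $ i - l $ i)"
    by (simp add: Basis_prod_def)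
  also have "\<dots> = (\<Prod>b\<in>Basis. (u - l) \<bullet> b)"
  proof -
    have "(Basis :: (real^2) set) = {axis i 1, axis j 1}"
      by (auto simp: Basis_vec_def UNIV_ij)
    then show ?thesis unfolding \<open>Basis = _\<close> using assms by (simp add: axis_eq_axis inner_axis)
  qed
  finally show "emeasure (distr lborel borel ?\<Phi>) (box l u) = (\<Prod>b\<in>Basis. (u - l) \<bullet> b)" .
qed simp

text \<open>On the chord of the disc at height \<open>y\<close> the partial derivative integrates to the difference of the values
  of \<open>h\<close> at the two end points, which lie on the circle, so to at most \<open>2 * M\<close> in absolute value. The
  heights range over an interval of length \<open>2 * r\<close>. This crude form of the divergence theorem
  on a disc gives no value of the flux, but a bound of the right order.\<close>

lemma integral_partial_derivative_disc_bound:
  fixes h :: "real^2 \<Rightarrow> real" and i :: 2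
  assumes h: "\<And>p. (h has_derivative h' p) (at p)"
    and cont: "continuous_on UNIV (\<lambda>p. h' p (axis i 1))"
    and bound: "\<And>p. norm p = r \<Longrightarrow> \<bar>h p\<bar> \<le> M"
    and "0 \<le> r"
  shows "\<bar>LINT p:cball 0 r|lborel. h' p (axis i 1)\<bar> \<le> 4 * r * M"
proof -
  obtain j :: 2 where "i \<noteq> j"
    by (metis zero_neq_one)
  define \<Phi> where "\<Phi> = (\<lambda>(y, x). y *\<^sub>R axis j 1 + x *\<^sub>R axis i 1 :: real^2)"
  define g where "g = (\<lambda>p. indicator (cball 0 r) p *\<^sub>R h' p (axis i 1))"
  have \<Phi>_meas: "\<Phi> \<in> lborel \<rightarrow>\<^sub>M borel"
    unfolding \<Phi>_def case_prod_beta measurable_lborel2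
    by (intro borel_measurable_continuous_onI continuous_intros)
  have distr: "distr lborel borel \<Phi> = lborel"
    using lborel_vec2_eq_distr[OF \<open>i \<noteq> j\<close>] by (simp add: \<Phi>_def)
  have norm_\<Phi>: "norm (\<Phi> (y, x)) = sqrt (y\<^sup>2 + x\<^sup>2)" for x y
    using \<open>i \<noteq> j\<close> by (simp add: \<Phi>_def norm_eq_sqrt_inner inner_add_left inner_add_right
        inner_axis_axis power2_eq_square)
  have g_int: "integrable lborel g"
    unfolding g_def by (intro borel_integrable_compact compact_cball continuous_on_subset[OF cont]) simp
  have g\<Phi>_int: "integrable (lborel \<Otimes>\<^sub>M lborel) (\<lambda>z. g (\<Phi> z))"
    unfolding lborel_prod by (rule integrable_distr[OF \<Phi>_meas]) (simp add: distr g_int)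
  have inner: "\<bar>\<integral>x. g (\<Phi> (y, x)) \<partial>lborel\<bar> \<le> indicator {-r..r} y * (2 * M)" for y
  proof (cases "\<bar>y\<bar> \<le> r")
    case True
    define s where "s = sqrt (r\<^sup>2 - y\<^sup>2)"
    have y2: "y\<^sup>2 \<le> r\<^sup>2"
      using True by (simp add: abs_le_square_iff[symmetric] \<open>0 \<le> r\<close>)
    have s: "0 \<le> s" "s\<^sup>2 = r\<^sup>2 - y\<^sup>2"
      using y2 by (auto simp: s_def)
    have "\<Phi> (y, x) \<in> cball 0 r \<longleftrightarrow> x \<in> {-s..s}" for x
    proof -
      have "norm (\<Phi> (y, x)) \<le> r \<longleftrightarrow> y\<^sup>2 + x\<^sup>2 \<le> r\<^sup>2"
        unfolding norm_\<Phi> using \<open>0 \<le> r\<close> real_sqrt_le_iff[of "y\<^sup>2 + x\<^sup>2" "r\<^sup>2"] by simp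
      also have "\<dots> \<longleftrightarrow> x\<^sup>2 \<le> s\<^sup>2" using s by auto
      also have "\<dots> \<longleftrightarrow> \<bar>x\<bar> \<le> s" using abs_le_square_iff[of x s] s(1) by simp
      finally show ?thesis by auto
    qed
    then have "(\<integral>x. g (\<Phi> (y, x)) \<partial>lborel) = (\<integral>x. indicator {-s..s} x *\<^sub>R h' (\<Phi> (y, x)) (axis i 1) \<partial>lborel)"
      by (intro Bochner_Integration.integral_cong) (auto simp: g_def indicator_def)
    also have "\<dots> = h (\<Phi> (y, s)) - h (\<Phi> (y, - s))"
    proof (rule integral_FTC_atLeastAtMost)
      fix x
      have "((\<lambda>x. \<Phi> (y, x)) has_derivative (\<lambda>t. t *\<^sub>R axis i 1)) (at x within {-s..s})"
        unfolding \<Phi>_def by (auto intro!: derivative_eq_intros)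
      from has_derivative_compose[OF this h]
      show "((\<lambda>x. h (\<Phi> (y, x))) has_vector_derivative h' (\<Phi> (y, x)) (axis i 1)) (at x within {-s..s})"
        using has_derivative_linear[OF h] by (simp add: has_vector_derivative_def linear_cmul)
    next
      show "continuous_on {-s..s} (\<lambda>x. h' (\<Phi> (y, x)) (axis i 1))"
        unfolding \<Phi>_def prod.case
        by (intro continuous_on_compose2[OF cont] continuous_intros) auto
    qed (use s in auto)
    also have "\<bar>\<dots>\<bar> \<le> M + M"
    proof -
      have "norm (\<Phi> (y, s)) = r" "norm (\<Phi> (y, - s)) = r"
        using s \<open>0 \<le> r\<close> by (auto simp: norm_\<Phi>)
      from this[THEN bound] show ?thesis by linarith
    qed
    finally show ?thesis using True by (simp add: abs_le_iff)
  next
    case False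
    have "g (\<Phi> (y, x)) = 0" for x
    proof -
      have "\<bar>y\<bar> \<le> norm (\<Phi> (y, x))" unfolding norm_\<Phi> by simp
      then show ?thesis using False by (simp add: g_def)
    qed
    then show ?thesis using False by (auto simp: indicator_def)
  qed
  have "(LINT p:cball 0 r|lborel. h' p (axis i 1)) = integral\<^sup>L (distr lborel borel \<Phi>) g"
    by (simp add: distr set_lebesgue_integral_def g_def)
  also have "\<dots> = (\<integral>z. g (\<Phi> z) \<partial>(lborel \<Otimes>\<^sub>M lborel))"
    using g_int \<Phi>_meas by (simp add: integral_distr lborel_prod)
  also have "\<dots> = (\<integral>y. (\<integral>x. g (\<Phi> (y, x)) \<partial>lborel) \<partial>lborel)"
    by (rule lborel_pair.integral_fst'[OF g\<Phi>_int, symmetric])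
  also have "\<bar>\<dots>\<bar> \<le> (\<integral>y. indicator {-r..r} y * (2 * M) \<partial>lborel)"
  proof (rule order_trans[OF integral_abs_bound integral_mono])
    show "integrable lborel (\<lambda>y. \<bar>\<integral>x. g (\<Phi> (y, x)) \<partial>lborel\<bar>)"
      by (intro integrable_abs lborel_pair.integrable_fst'[OF g\<Phi>_int])
    show "integrable lborel (\<lambda>y. indicator {-r..r} y * (2 * M))"
      using borel_integrable_compact[of "{-r..r}" "\<lambda>_. 2 * M"] by simp
  qed (rule inner)
  also have "\<dots> = 4 * r * M"
    using \<open>0 \<le> r\<close> by simp
  finally show ?thesis .
qed

text \<open>A directional derivative is a combination of the two partial derivatives with coefficients at most
  \<open>norm w\<close>.\<close>

lemma integral_directional_derivative_disc_bound:
  fixes h :: "real^2 \<Rightarrow> real"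
  assumes h: "\<And>p. (h has_derivative h' p) (at p)"
    and cont: "\<And>w. continuous_on UNIV (\<lambda>p. h' p w)"
    and bound: "\<And>p. norm p = r \<Longrightarrow> \<bar>h p\<bar> \<le> M"
    and "0 \<le> r" "0 \<le> M"
  shows "\<bar>LINT p:cball 0 r|lborel. h' p w\<bar> \<le> 8 * r * M * norm w"
proof -
  have int: "set_integrable lborel (cball 0 r) (\<lambda>p. h' p v)" for v
    unfolding set_integrable_def
    by (intro borel_integrable_compact compact_cball continuous_on_subset[OF cont]) simp
  have "h' p w = w $ 1 * h' p (axis 1 1) + w $ 2 * h' p (axis 2 1)" for p
  proof -
    have "h' p (w $ 1 *\<^sub>R axis 1 1 + w $ 2 *\<^sub>R axis 2 1) = w $ 1 * h' p (axis 1 1) + w $ 2 * h' p (axis 2 1)"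
      using has_derivative_linear[OF h, of p] by (simp add: linear_add linear_cmul)
    moreover have "w $ 1 *\<^sub>R axis 1 1 + w $ 2 *\<^sub>R axis 2 1 = w"
      by (simp add: vec_eq_iff forall_2 axis_def)
    ultimately show ?thesis by simp
  qed
  then have "\<bar>LINT p:cball 0 r|lborel. h' p w\<bar> =
      \<bar>w $ 1 * (LINT p:cball 0 r|lborel. h' p (axis 1 1)) + w $ 2 * (LINT p:cball 0 r|lborel. h' p (axis 2 1))\<bar>"
    by (simp add: int)
  also have "\<dots> \<le> norm w * (4 * r * M) + norm w * (4 * r * M)"
    by (intro order_trans[OF abs_triangle_ineq] add_mono, unfold abs_mult)
      (intro mult_mono integral_partial_derivative_disc_bound[OF h cont bound \<open>0 \<le> r\<close>]
        component_le_norm_cart norm_ge_zero abs_ge_zero; simp)+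
  finally show ?thesis by (simp add: algebra_simps)
qed

text \<open>If the complement of the zero set is connected, then \<open>g\<close> has constant sign on it, hence everywhere.
  A nonnegative \<open>g\<close> that is positive somewhere has disc integrals that stay above a positive
  constant, namely a lower bound for its integral over one small ball.\<close>

lemma lim_disc_integrals_zero_imp_zero_set_separates:
  fixes g :: "'a::euclidean_space \<Rightarrow> real"
  assumes cont: "continuous_on UNIV g"
    and lim: "((\<lambda>r. LINT p:cball 0 r|lborel. g p) \<longlongrightarrow> 0) at_top"
  shows "{p. g p = 0} = UNIV \<or> \<not> connected (- {p. g p = 0})"
proof -
  have no_pos: "g q \<le> 0" if cont: "continuous_on UNIV g"
    and lim: "((\<lambda>r. LINT p:cball 0 r|lborel. g p) \<longlongrightarrow> 0) at_top"
    and nonneg: "\<And>p. 0 \<le> g p" for g :: "'a \<Rightarrow> real" and q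
  proof (rule ccontr)
    assume "\<not> g q \<le> 0"
    then have "0 < g q / 2" by simp
    with cont obtain d where "0 < d" and d: "\<And>p. dist p q < d \<Longrightarrow> dist (g p) (g q) < g q / 2"
      unfolding continuous_on_iff by (metis UNIV_I)
    define \<delta> where "\<delta> = d / 2"
    have "0 < \<delta>" and \<delta>: "\<And>p. dist p q \<le> \<delta> \<Longrightarrow> dist (g p) (g q) < g q / 2"
      using \<open>0 < d\<close> d by (auto simp: \<delta>_def)
    define c where "c = measure lborel (cball q \<delta>) * (g q / 2)"
    have "0 < c"
      using content_cball_pos[OF \<open>0 < \<delta>\<close>, of q] \<open>0 < g q / 2\<close> by (simp add: c_def)
    have "c \<le> (LINT p:cball 0 r|lborel. g p)" if "norm q + \<delta> \<le> r" for r
    proof -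
      have "c = (LINT p:cball q \<delta>|lborel. g q / 2)"
        by (simp add: c_def set_lebesgue_integral_def)
      also have "\<dots> \<le> (LINT p:cball 0 r|lborel. g p)"
        unfolding set_lebesgue_integral_def
      proof (rule integral_mono)
        show "integrable lborel (\<lambda>p. indicat_real (cball q \<delta>) p *\<^sub>R (g q / 2))"
          by (intro borel_integrable_compact) auto
        show "integrable lborel (\<lambda>p. indicat_real (cball 0 r) p *\<^sub>R g p)"
          by (intro borel_integrable_compact continuous_on_subset[OF cont]) auto
        fix p
        show "indicat_real (cball q \<delta>) p *\<^sub>R (g q / 2) \<le> indicat_real (cball 0 r) p *\<^sub>R g p"
        proof (cases "p \<in> cball q \<delta>")
          case True
          then have "dist p q \<le> \<delta>" by (simp add: dist_commute)
          moreover have "norm p \<le> norm q + dist p q"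
            using norm_triangle_ineq[of q "p - q"] by (simp add: dist_norm)
          moreover have "g q / 2 \<le> g p"
            using \<delta>[OF \<open>dist p q \<le> \<delta>\<close>] unfolding dist_real_def by linarith
          ultimately show ?thesis
            using True that by auto
        qed (auto simp: nonneg)
      qed
      finally show ?thesis .
    qed
    then have "\<forall>\<^sub>F r in at_top. c \<le> (LINT p:cball 0 r|lborel. g p)"
      by (auto simp: eventually_at_top_linorder)
    from tendsto_lowerbound[OF lim this] \<open>0 < c\<close> show False by simp
  qed
  have "{p. g p = 0} = UNIV" if "connected (- {p. g p = 0})"
  proof -
    have "connected (g ` (- {p. g p = 0}))"
      using that by (intro connected_continuous_image continuous_on_subset[OF cont]) auto
    (* The interval from a negative to a positive value would contain 0, which is not a value of g
       on the complement of its zero set. *)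
    then have "g p \<le> 0" if "g q < 0" for p q
      using that connectedD_interval[of "g ` (- {p. g p = 0})" "g q" "g p" 0] by force
    then consider "\<And>p. 0 \<le> g p" | "\<And>p. 0 \<le> - g p"
      by (metis le_minus_iff minus_zero not_le)
    then show ?thesis
    proof cases
      case 1
      then show ?thesis using no_pos[OF cont lim] by (auto intro: antisym)
    next
      case 2
      have "((\<lambda>r. LINT p:cball 0 r|lborel. - g p) \<longlongrightarrow> 0) at_top"
        using tendsto_minus[OF lim] by (simp add: set_lebesgue_integral_def)
      from no_pos[OF continuous_on_minus[OF cont] this] 2 show ?thesis by (auto intro: antisym)
    qed
  qed
  then show ?thesis by blast
qed

section \<open>Gradient and Hessian\<close>

lemma grad_eqI:
  assumes "GDERIV f p :> D"
  shows "grad f p = D"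
  unfolding grad_def
proof (rule the_equality)
  show "GDERIV f p :> D" by (rule assms)
  fix D' assume "GDERIV f p :> D'"
  then have "(\<lambda>w. w \<bullet> D') = (\<lambda>w. w \<bullet> D)"
    using assms unfolding gderiv_def by (rule has_derivative_unique)
  then have "(D' - D) \<bullet> (D' - D) = 0"
    by (metis (no_types) eq_iff_diff_eq_0 inner_diff_right)
  then show "D' = D" by simp
qed

text \<open>The gradient is defined by a description operator; the Riesz representation of the derivative shows
  that the described vector exists, so that it may be replaced by any known derivative.\<close>

lemma dir_deriv_eq:
  fixes h :: "'a::euclidean_space \<Rightarrow> real"
  assumes h: "(h has_derivative h') (at p)"
  shows "dir_deriv h w p = h' w"
proof -
  have lin: "linear h'" using h by (rule has_derivative_linear)
  have riesz: "h' v = v \<bullet> (\<Sum>b\<in>Basis. h' b *\<^sub>R b)" for v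
  proof -
    have "h' v = h' (\<Sum>b\<in>Basis. (v \<bullet> b) *\<^sub>R b)" by (simp add: euclidean_representation)
    then show ?thesis
      using lin by (simp add: linear_sum linear_cmul inner_sum_right mult.commute)
  qed
  then have "grad h p = (\<Sum>b\<in>Basis. h' b *\<^sub>R b)"
    using h by (intro grad_eqI) (simp add: gderiv_def flip: riesz)
  then show ?thesis
    using riesz[of w] by (simp add: dir_deriv_def inner_commute)
qed

lemma has_derivative_grad:
  fixes f :: "'a::euclidean_space \<Rightarrow> real"
  assumes "(f has_derivative f') (at p)"
  shows "(f has_derivative (\<lambda>w. grad f p \<bullet> w)) (at p)"
  using assms dir_deriv_eq[OF assms] by (simp add: dir_deriv_def)

text \<open>What the argument uses of a \<open>C\<^sup>2\<close> function on the plane: \<open>H p\<close> is the Hessian at \<open>p\<close> as a self-adjoint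
  linear map.\<close>

locale hessian =
  fixes f :: "real^2 \<Rightarrow> real" and H :: "real^2 \<Rightarrow> real^2 \<Rightarrow> real^2"
  assumes grad: "(f has_derivative (\<lambda>w. grad f p \<bullet> w)) (at p)"
    and hess: "(grad f has_derivative H p) (at p)"
    and hess_symmetric: "H p u \<bullet> v = H p v \<bullet> u"
    and hess_continuous: "continuous_on UNIV (\<lambda>p. H p w)"

lemma C2_imp_hessian:
  assumes "C2 f"
  shows "\<exists>H. hessian f H"
proof -
  obtain f' f'' where f': "\<And>p. (f has_derivative blinfun_apply (f' p)) (at p)"
    and f'': "\<And>p. (f' has_derivative blinfun_apply (f'' p)) (at p)"
    and cont: "continuous_on UNIV f''"
    using assms unfolding C2_def by blast
  define H where "H p w = (\<Sum>b\<in>Basis. blinfun_apply (blinfun_apply (f'' p) w) b *\<^sub>R b)" for p w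
  have grad_f: "grad f p = (\<Sum>b\<in>Basis. blinfun_apply (f' p) b *\<^sub>R b)" for p
    using dir_deriv_eq[OF f', of _ p] euclidean_representation[of "grad f p"]
    by (simp add: dir_deriv_def)
  have H_inner: "H p u \<bullet> v = blinfun_apply (blinfun_apply (f'' p) u) v" for p u v
  proof -
    have "blinfun_apply (blinfun_apply (f'' p) u) v =
        blinfun_apply (blinfun_apply (f'' p) u) (\<Sum>b\<in>Basis. (v \<bullet> b) *\<^sub>R b)"
      by (simp add: euclidean_representation)
    then show ?thesis
      by (simp add: H_def inner_sum_left blinfun.sum_right blinfun.scaleR_right inner_commute[of v] mult.commute)
  qed
  have "hessian f H"
  proof
    show "(f has_derivative (\<lambda>w. grad f p \<bullet> w)) (at p)" for p
      using f' by (rule has_derivative_grad)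
    show "(grad f has_derivative H p) (at p)" for p
      unfolding grad_f[abs_def] H_def
      by (intro has_derivative_sum has_derivative_scaleR_left)
        (rule has_derivative_compose[OF f'' bounded_linear_imp_has_derivative[OF blinfun.bounded_linear_left]])
    show "H p u \<bullet> v = H p v \<bullet> u" for p u v
      using second_derivative_symmetric[OF f' f'' cont] by (simp add: H_inner)
    show "continuous_on UNIV (\<lambda>p. H p w)" for w
      unfolding H_def by (intro continuous_intros cont)
  qed
  then show ?thesis by blast
qed

section \<open>Directions in the plane\<close>

lemma inner_unit_dir:
  "unit_dir \<alpha> \<bullet> unit_dir \<beta> = cos (\<alpha> - \<beta>)"
  by (simp add: unit_dir_def inner_vec_def sum_2 cos_diff)

lemma norm_unit_dir [simp]: "norm (unit_dir \<theta>) = 1"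
  by (simp add: norm_eq_sqrt_inner inner_unit_dir)

lemma unit_dir_rotate:
  "unit_dir \<beta> = cos (\<beta> - \<alpha>) *\<^sub>R unit_dir \<alpha> + sin (\<beta> - \<alpha>) *\<^sub>R unit_dir (\<alpha> + pi / 2)"
proof -
  have "cos (\<alpha> + (\<beta> - \<alpha>)) = cos (\<beta> - \<alpha>) * cos \<alpha> - sin (\<beta> - \<alpha>) * sin \<alpha>"
    "sin (\<alpha> + (\<beta> - \<alpha>)) = cos (\<beta> - \<alpha>) * sin \<alpha> + sin (\<beta> - \<alpha>) * cos \<alpha>"
    unfolding cos_add sin_add by simp_all
  then show ?thesis
    by (simp add: unit_dir_def vec_eq_iff forall_2 sin_add[of \<alpha> "pi/2"] cos_add[of \<alpha> "pi/2"])
qed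

lemma orthonormal_frame_expansion:
  "w = (w \<bullet> unit_dir \<theta>) *\<^sub>R unit_dir \<theta> + (w \<bullet> unit_dir (\<theta> + pi / 2)) *\<^sub>R unit_dir (\<theta> + pi / 2)"
proof -
  have "a = (a * c + b * s) * c - (b * c - a * s) * s" "b = (a * c + b * s) * s + (b * c - a * s) * c"
    if "c\<^sup>2 + s\<^sup>2 = 1" for a b c s :: real
    using that by algebra+
  from this[OF sin_cos_squared_add2[of \<theta>]] show ?thesis
    by (simp add: unit_dir_def vec_eq_iff forall_2 inner_vec_def sum_2 sin_add cos_add)
qed

lemma polar_representation:
  fixes p :: "real^2"
  shows "\<exists>\<theta>. p = norm p *\<^sub>R unit_dir \<theta>"
proof (cases "p = 0")
  case False
  have "(p $ 1)\<^sup>2 + (p $ 2)\<^sup>2 = (norm p)\<^sup>2"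
    by (simp add: norm_vec_def L2_set_def sum_2)
  then have "(p $ 1 / norm p)\<^sup>2 + (p $ 2 / norm p)\<^sup>2 = 1"
    using False by (simp add: power_divide flip: add_divide_distrib)
  from sincos_total_2pi[OF this] obtain \<theta> where "p $ 1 / norm p = cos \<theta>" "p $ 2 / norm p = sin \<theta>"
    by blast
  then have "p $ 1 = norm p * cos \<theta>" "p $ 2 = norm p * sin \<theta>"
    using False by (metis nonzero_mult_div_cancel_left norm_eq_zero times_divide_eq_right)+
  then have "p = norm p *\<^sub>R unit_dir \<theta>"
    by (simp add: unit_dir_def vec_eq_iff forall_2)
  then show ?thesis by blast
qed simp

section \<open>Normal curvature and principal directions\<close>

context hessian
begin

text \<open>In the notation of the statement \<open>slope \<alpha>\<close> is \<open>f\<^sub>A\<close> and \<open>bend \<alpha> \<beta>\<close> is \<open>f\<^sub>A\<^sub>B\<close>, where \<open>A\<close> and \<open>B\<close> are the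
  directions with angles \<open>\<alpha>\<close> and \<open>\<beta>\<close>. The direction with angle \<open>\<theta> + pi / 2\<close> is both the normal of
  the direction \<open>X\<close> with angle \<open>\<theta>\<close> and the derivative of \<open>X\<close> with respect to \<open>\<theta>\<close>; it is called \<open>Y\<close>
  below.\<close>

definition slope :: "real \<Rightarrow> real^2 \<Rightarrow> real" where
  "slope \<alpha> p = grad f p \<bullet> unit_dir \<alpha>"

definition bend :: "real \<Rightarrow> real \<Rightarrow> real^2 \<Rightarrow> real" where
  "bend \<alpha> \<beta> p = H p (unit_dir \<alpha>) \<bullet> unit_dir \<beta>"

text \<open>The curvature integrand with all denominators but \<open>1 + f\<^sub>X\<^sup>2\<close> cancelled, that is,
  \<open>2 f\<^sub>X\<^sub>Y - 2 f\<^sub>X\<^sub>X f\<^sub>X f\<^sub>Y / (1 + f\<^sub>X\<^sup>2)\<close>.\<close>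

definition principal_defect :: "real \<Rightarrow> real^2 \<Rightarrow> real" where
  "principal_defect \<theta> p = 2 * bend \<theta> (\<theta> + pi / 2) p
     - 2 * bend \<theta> \<theta> p * slope \<theta> p * slope (\<theta> + pi / 2) p / (1 + (slope \<theta> p)\<^sup>2)"

lemma bend_commute: "bend \<alpha> \<beta> p = bend \<beta> \<alpha> p"
  unfolding bend_def by (rule hess_symmetric)

lemma slope_has_derivative: "(slope \<alpha> has_derivative (\<lambda>w. H p w \<bullet> unit_dir \<alpha>)) (at p)"
  unfolding slope_def[abs_def] by (auto intro!: derivative_eq_intros hess)

lemma continuous_on_grad: "continuous_on UNIV (grad f)"
  using hess by (intro has_derivative_continuous_on) auto

lemma continuous_on_slope [continuous_intros]: "continuous_on S (slope \<alpha>)"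
  unfolding slope_def[abs_def]
  by (intro continuous_intros continuous_on_subset[OF continuous_on_grad]) simp

lemma continuous_on_bend [continuous_intros]: "continuous_on S (bend \<alpha> \<beta>)"
  unfolding bend_def[abs_def]
  by (intro continuous_intros continuous_on_subset[OF hess_continuous]) simp

lemma one_plus_slope_pos: "0 < 1 + (slope \<alpha> p)\<^sup>2"
  by (simp add: add_pos_nonneg)

lemma continuous_on_principal_defect: "continuous_on UNIV (principal_defect \<theta>)"
  unfolding principal_defect_def[abs_def]
  by (intro continuous_intros ballI) (metis less_irrefl one_plus_slope_pos)

lemma dir_deriv_slope: "dir_deriv f (unit_dir \<alpha>) = slope \<alpha>"
  by (simp add: fun_eq_iff dir_deriv_def slope_def)

lemma dir_deriv_bend: "dir_deriv (dir_deriv f (unit_dir \<alpha>)) (unit_dir \<beta>) p = bend \<beta> \<alpha> p"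
  unfolding dir_deriv_slope bend_def using slope_has_derivative by (rule dir_deriv_eq)

lemma area_density_pos: "0 < area_density f p"
  by (simp add: area_density_def add_pos_nonneg)

lemma area_density_squared:
  "(area_density f p)\<^sup>2 = 1 + (slope \<theta> p)\<^sup>2 + (slope (\<theta> + pi / 2) p)\<^sup>2"
proof -
  have "(norm (grad f p))\<^sup>2 = grad f p \<bullet>
      ((grad f p \<bullet> unit_dir \<theta>) *\<^sub>R unit_dir \<theta> + (grad f p \<bullet> unit_dir (\<theta> + pi / 2)) *\<^sub>R unit_dir (\<theta> + pi / 2))"
    by (simp add: power2_norm_eq_inner flip: orthonormal_frame_expansion)
  then show ?thesis
    by (simp add: area_density_def slope_def inner_add_right power2_eq_square)
qed

text \<open>Expanding the direction of angle \<open>t\<close> in the frame \<open>X\<close>, \<open>Y\<close> makes the normal curvature an explicit quotient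
  of trigonometric expressions in \<open>t - \<theta>\<close>. The area density does not depend on the direction, so only
  the second derivative of \<open>f\<close> and the factor \<open>1 + f\<^sub>X\<^sup>2\<close> contribute to the derivative at \<open>t = \<theta>\<close>.\<close>

lemma curvature_integrand_eq_principal_defect:
  "normal_curvature_deriv f p \<theta> * (1 + (dir_deriv f (unit_dir \<theta>) p)\<^sup>2) * area_density f p
     = principal_defect \<theta> p"
proof -
  let ?Y = "\<theta> + pi / 2"
  let ?a = "bend \<theta> \<theta> p" and ?b = "bend \<theta> ?Y p" and ?d = "bend ?Y ?Y p"
  let ?u = "slope \<theta> p" and ?v = "slope ?Y p" and ?W = "area_density f p"
  have pos: "0 < 1 + ?u\<^sup>2" "0 < ?W"
    by (rule one_plus_slope_pos area_density_pos)+
  have lin: "linear (H p)"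
    using hess by (rule has_derivative_linear)
  have slope_eq: "slope t p = cos (t - \<theta>) * ?u + sin (t - \<theta>) * ?v" for t
    unfolding slope_def unit_dir_rotate[of t \<theta>] by (simp add: inner_add_right)
  have bend_eq: "bend t t p = (cos (t - \<theta>))\<^sup>2 * ?a + 2 * cos (t - \<theta>) * sin (t - \<theta>) * ?b + (sin (t - \<theta>))\<^sup>2 * ?d" for t
    using bend_commute[of ?Y \<theta> p] unfolding bend_def unit_dir_rotate[of t \<theta>]
    by (simp add: lin linear_add linear_cmul inner_add_right inner_add_left power2_eq_square algebra_simps)
  have curvature: "normal_curvature f p (unit_dir t) =
      ((cos (t - \<theta>))\<^sup>2 * ?a + 2 * cos (t - \<theta>) * sin (t - \<theta>) * ?b + (sin (t - \<theta>))\<^sup>2 * ?d)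
        / ((1 + (cos (t - \<theta>) * ?u + sin (t - \<theta>) * ?v)\<^sup>2) * ?W)" for t
    unfolding normal_curvature_def dir_deriv_bend unfolding dir_deriv_slope
    by (simp only: bend_eq[of t] slope_eq[of t])
  have num: "((\<lambda>t. (cos (t - \<theta>))\<^sup>2 * a + 2 * cos (t - \<theta>) * sin (t - \<theta>) * b + (sin (t - \<theta>))\<^sup>2 * d)
      has_real_derivative 2 * b) (at \<theta>)" for a b d
    by (auto intro!: derivative_eq_intros)
  have den: "((\<lambda>t. (1 + (cos (t - \<theta>) * u + sin (t - \<theta>) * v)\<^sup>2) * W)
      has_real_derivative 2 * u * v * W) (at \<theta>)" for u v W
    by (auto intro!: derivative_eq_intros)
  have "((\<lambda>t. normal_curvature f p (unit_dir t)) has_real_derivative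
      (2 * ?b * ((1 + ?u\<^sup>2) * ?W) - ?a * (2 * ?u * ?v * ?W)) / (((1 + ?u\<^sup>2) * ?W) * ((1 + ?u\<^sup>2) * ?W))) (at \<theta>)"
    using DERIV_divide[OF num[of ?a ?b ?d] den[of ?u ?v ?W]] pos
    unfolding curvature by simp
  note derivative = DERIV_imp_deriv[OF this]
  have "(2 * b * (q * W) - a * (2 * u * v * W)) / ((q * W) * (q * W)) * q * W = 2 * b - 2 * a * u * v / q"
    if "0 < q" "0 < W" for a b q u v W :: real
    using that by (simp add: field_simps)
  from this[OF pos] show ?thesis
    unfolding normal_curvature_deriv_def derivative principal_defect_def dir_deriv_slope .
qed

text \<open>The second term comes from the vector \<open>(- grad f, 1)\<close>, the first from its normalisation, for which
  the area density \<open>W\<close> satisfies \<open>W' = \<langle>grad f, H w\<rangle> / W\<close>.\<close>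

lemma graph_normal_has_derivative:
  "(graph_normal f has_derivative
     (\<lambda>w. - ((grad f p \<bullet> H p w) / (area_density f p) ^ 3) *\<^sub>R (- grad f p, 1)
          + (1 / area_density f p) *\<^sub>R (- H p w, 0))) (at p)"
proof -
  let ?W = "area_density f"
  have pos: "0 < 1 + grad f p \<bullet> grad f p"
    by (simp add: add_pos_nonneg)
  have W: "?W = (\<lambda>q. sqrt (1 + grad f q \<bullet> grad f q))"
    by (simp add: fun_eq_iff area_density_def power2_norm_eq_inner)
  have "(?W has_derivative (\<lambda>w. (grad f p \<bullet> H p w) / ?W p)) (at p)"
    unfolding W using pos
    by (auto intro!: derivative_eq_intros hess simp: inner_commute field_simps)
  then have "((\<lambda>q. 1 / ?W q) has_derivative (\<lambda>w. - ((grad f p \<bullet> H p w) / (?W p) ^ 3))) (at p)"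
    using area_density_pos[of p]
    by (auto intro!: derivative_eq_intros simp: field_simps power3_eq_cube)
  moreover have "((\<lambda>q. (- grad f q, 1)) has_derivative (\<lambda>w. (- H p w, 0))) (at p)"
    by (auto intro!: derivative_eq_intros hess)
  ultimately have "((\<lambda>q. (1 / ?W q) *\<^sub>R (- grad f q, 1)) has_derivative (\<lambda>w.
      (1 / ?W p) *\<^sub>R (- H p w, 0) + (- ((grad f p \<bullet> H p w) / (?W p) ^ 3)) *\<^sub>R (- grad f p, 1))) (at p)"
    by (rule has_derivative_scaleR)
  then show ?thesis
    unfolding graph_normal_def[abs_def] by (simp only: add.commute)
qed

text \<open>The eigenvector equation of the shape operator, split into its horizontal and its vertical part;
  tangency determines the vertical component of \<open>v\<close>.\<close>

lemma graph_principal_direction_iff: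
  "graph_principal_direction f p v \<longleftrightarrow> fst v \<noteq> 0 \<and> snd v = grad f p \<bullet> fst v \<and>
     (\<exists>\<kappa>. (1 / area_density f p) *\<^sub>R H p (fst v)
            - ((grad f p \<bullet> H p (fst v)) / (area_density f p) ^ 3) *\<^sub>R grad f p = \<kappa> *\<^sub>R fst v
        \<and> (grad f p \<bullet> H p (fst v)) / (area_density f p) ^ 3 = \<kappa> * (grad f p \<bullet> fst v))"
proof -
  have "shape_operator f p v =
     ((1 / area_density f p) *\<^sub>R H p (fst v)
            - ((grad f p \<bullet> H p (fst v)) / (area_density f p) ^ 3) *\<^sub>R grad f p,
      (grad f p \<bullet> H p (fst v)) / (area_density f p) ^ 3)"
    unfolding shape_operator_def frechet_derivative_at[OF graph_normal_has_derivative, symmetric]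
    by simp
  then have "shape_operator f p v = \<kappa> *\<^sub>R v \<longleftrightarrow>
      (1 / area_density f p) *\<^sub>R H p (fst v)
            - ((grad f p \<bullet> H p (fst v)) / (area_density f p) ^ 3) *\<^sub>R grad f p = \<kappa> *\<^sub>R fst v
        \<and> (grad f p \<bullet> H p (fst v)) / (area_density f p) ^ 3 = \<kappa> * snd v" for \<kappa>
    by (simp add: prod_eq_iff)
  moreover have "v \<in> graph_tangent_space f p \<and> v \<noteq> 0 \<longleftrightarrow> fst v \<noteq> 0 \<and> snd v = grad f p \<bullet> fst v"
    by (cases v) (auto simp: graph_tangent_space_def dir_deriv_def zero_prod_def)
  ultimately show ?thesis
    unfolding graph_principal_direction_def by metis
qed

text \<open>The eigenvector equation for the lift of \<open>X\<close> has three scalar components, along \<open>X\<close>, along \<open>Y\<close> and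
  vertical. The first determines the eigenvalue. The second, after multiplication by powers of the area
  density \<open>W\<close> and insertion of \<open>W\<^sup>2 = 1 + f\<^sub>X\<^sup>2 + f\<^sub>Y\<^sup>2\<close>, says that the principal defect vanishes. The third
  then follows, because the image of the shape operator is tangent to the graph.\<close>

lemma principal_direction_iff:
  "principal_direction f p (unit_dir \<theta>) \<longleftrightarrow> principal_defect \<theta> p = 0"
proof -
  let ?X = "unit_dir \<theta>" and ?Y = "unit_dir (\<theta> + pi / 2)"
  let ?a = "bend \<theta> \<theta> p" and ?b = "bend \<theta> (\<theta> + pi / 2) p"
  let ?u = "slope \<theta> p" and ?v = "slope (\<theta> + pi / 2) p" and ?W = "area_density f p"
  have W: "0 < ?W" "?W\<^sup>2 = 1 + ?u\<^sup>2 + ?v\<^sup>2"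
    by (rule area_density_pos area_density_squared)+
  have lin: "linear (H p)"
    using hess by (rule has_derivative_linear)
  let ?G = "grad f p \<bullet> H p ?X"
  have G: "?G = ?u * ?a + ?v * ?b"
    by (subst orthonormal_frame_expansion[of "H p ?X" \<theta>])
      (simp add: inner_add_right bend_def slope_def mult.commute)
  have "principal_direction f p ?X \<longleftrightarrow> (\<exists>\<kappa>. (1 / ?W) *\<^sub>R H p ?X - (?G / ?W ^ 3) *\<^sub>R grad f p = \<kappa> *\<^sub>R ?X
        \<and> ?G / ?W ^ 3 = \<kappa> * ?u)"
  proof
    assume "\<exists>\<kappa>. (1 / ?W) *\<^sub>R H p ?X - (?G / ?W ^ 3) *\<^sub>R grad f p = \<kappa> *\<^sub>R ?X \<and> ?G / ?W ^ 3 = \<kappa> * ?u"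
    then have "graph_principal_direction f p (?X, ?u)"
      unfolding graph_principal_direction_iff slope_def
      using norm_unit_dir[of \<theta>] by (auto simp del: norm_unit_dir)
    then show "principal_direction f p ?X"
      unfolding principal_direction_def by (intro exI[of _ "(?X, ?u)"] conjI exI[of _ 1]) auto
  next
    assume "principal_direction f p ?X"
    then obtain v :: "(real^2) \<times> real" and c \<kappa> where c: "c \<noteq> 0" "?X = c *\<^sub>R fst v"
      and eq1: "(1 / ?W) *\<^sub>R H p (fst v) - ((grad f p \<bullet> H p (fst v)) / ?W ^ 3) *\<^sub>R grad f p = \<kappa> *\<^sub>R fst v"
      and eq2: "(grad f p \<bullet> H p (fst v)) / ?W ^ 3 = \<kappa> * (grad f p \<bullet> fst v)"
      unfolding principal_direction_def graph_principal_direction_iff by blast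
    have HX: "H p ?X = c *\<^sub>R H p (fst v)"
      unfolding c(2) using lin by (rule linear_cmul)
    have "(1 / ?W) *\<^sub>R H p ?X - (?G / ?W ^ 3) *\<^sub>R grad f p
        = c *\<^sub>R ((1 / ?W) *\<^sub>R H p (fst v) - ((grad f p \<bullet> H p (fst v)) / ?W ^ 3) *\<^sub>R grad f p)"
      unfolding HX by (simp add: scaleR_diff_right)
    also have "\<dots> = \<kappa> *\<^sub>R ?X"
      unfolding eq1 c(2) by simp
    finally have "(1 / ?W) *\<^sub>R H p ?X - (?G / ?W ^ 3) *\<^sub>R grad f p = \<kappa> *\<^sub>R ?X" .
    moreover have "?G / ?W ^ 3 = c * ((grad f p \<bullet> H p (fst v)) / ?W ^ 3)"
      unfolding HX by simp
    then have "?G / ?W ^ 3 = \<kappa> * ?u"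
      unfolding eq2 slope_def c(2) by simp
    ultimately show "\<exists>\<kappa>. (1 / ?W) *\<^sub>R H p ?X - (?G / ?W ^ 3) *\<^sub>R grad f p = \<kappa> *\<^sub>R ?X \<and> ?G / ?W ^ 3 = \<kappa> * ?u"
      by blast
  qed
  also have "\<dots> \<longleftrightarrow> (\<exists>\<kappa>. ?a / ?W - ?G / ?W ^ 3 * ?u = \<kappa> \<and> ?b / ?W - ?G / ?W ^ 3 * ?v = 0 \<and> ?G / ?W ^ 3 = \<kappa> * ?u)"
  proof -
    have "w = \<kappa> *\<^sub>R ?X \<longleftrightarrow> w \<bullet> ?X = \<kappa> \<and> w \<bullet> ?Y = 0" for w \<kappa>
    proof
      assume "w \<bullet> ?X = \<kappa> \<and> w \<bullet> ?Y = 0"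
      then show "w = \<kappa> *\<^sub>R ?X" using orthonormal_frame_expansion[of w \<theta>] by simp
    qed (simp add: inner_unit_dir)
    then show ?thesis
      by (simp add: inner_diff_left bend_def slope_def conj_assoc)
  qed
  also have "\<dots> \<longleftrightarrow> ?b / ?W - ?G / ?W ^ 3 * ?v = 0 \<and> ?G / ?W ^ 3 = (?a / ?W - ?G / ?W ^ 3 * ?u) * ?u"
    by blast
  also have "\<dots> \<longleftrightarrow> ?b * ?W\<^sup>2 = ?G * ?v \<and> ?G = (?a * ?W\<^sup>2 - ?G * ?u) * ?u"
  proof -
    have "b / W - G / W ^ 3 * v = (b * W\<^sup>2 - G * v) / W ^ 3"
      "(a / W - G / W ^ 3 * u) * u = (a * W\<^sup>2 - G * u) * u / W ^ 3"
      if "0 < W" for a b u v G W :: real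
      using that by (simp_all add: field_simps power3_eq_cube power2_eq_square)
    then show ?thesis using W(1) by simp
  qed
  (* The difference of the two sides of the second equation is a multiple of that of the first. *)
  also have "\<dots> \<longleftrightarrow> ?b * (1 + ?u\<^sup>2) = ?a * ?u * ?v"
  proof -
    have "b * (1 + u\<^sup>2 + v\<^sup>2) - (u * a + v * b) * v = b * (1 + u\<^sup>2) - a * u * v"
      "(a * (1 + u\<^sup>2 + v\<^sup>2) - (u * a + v * b) * u) * u - (u * a + v * b) = v * (a * u * v - b * (1 + u\<^sup>2))"
      for a b u v :: real
      by (simp_all add: algebra_simps power2_eq_square)
    from this[of ?b ?u ?v ?a] this[of ?a ?u ?v ?b] show ?thesis
      unfolding W(2) G by auto
  qed
  also have "\<dots> \<longleftrightarrow> principal_defect \<theta> p = 0"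
    using one_plus_slope_pos[of \<theta> p] by (auto simp: principal_defect_def field_simps)
  finally show ?thesis .
qed


section \<open>The curvature integrand as a divergence\<close>

text \<open>The components along \<open>X\<close> and \<open>Y\<close> of a vector field whose divergence is the principal defect. To get the
  term \<open>- 2 f\<^sub>X\<^sub>X f\<^sub>X f\<^sub>Y / (1 + f\<^sub>X\<^sup>2)\<close> from an \<open>X\<close>-derivative of \<open>f\<^sub>Y \<phi>(f\<^sub>X)\<close>, one needs
  \<open>\<phi>(t) = - ln (1 + t\<^sup>2)\<close>. What is left of the defect is \<open>f\<^sub>X\<^sub>Y (2 + ln (1 + f\<^sub>X\<^sup>2))\<close>, the \<open>Y\<close>-derivative
  of \<open>\<psi>(f\<^sub>X)\<close> for the primitive \<open>\<psi>(t) = t ln (1 + t\<^sup>2) + 2 arctan t\<close> of \<open>2 + ln (1 + t\<^sup>2)\<close>.\<close>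

definition potential_along :: "real \<Rightarrow> real^2 \<Rightarrow> real" where
  "potential_along \<theta> p = - (slope (\<theta> + pi / 2) p * ln (1 + (slope \<theta> p)\<^sup>2))"

definition potential_across :: "real \<Rightarrow> real^2 \<Rightarrow> real" where
  "potential_across \<theta> p = slope \<theta> p * ln (1 + (slope \<theta> p)\<^sup>2) + 2 * arctan (slope \<theta> p)"

lemma potential_along_has_derivative:
  "(potential_along \<theta> has_derivative (\<lambda>w.
      - (H p w \<bullet> unit_dir (\<theta> + pi / 2) * ln (1 + (slope \<theta> p)\<^sup>2)
         + slope (\<theta> + pi / 2) p * (2 * slope \<theta> p * (H p w \<bullet> unit_dir \<theta>) / (1 + (slope \<theta> p)\<^sup>2))))) (at p)"
  unfolding potential_along_def[abs_def]
  by (rule derivative_eq_intros slope_has_derivative one_plus_slope_pos refl | simp add: fun_eq_iff field_simps)+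

lemma potential_across_has_derivative:
  "(potential_across \<theta> has_derivative (\<lambda>w.
      (ln (1 + (slope \<theta> p)\<^sup>2) + 2) * (H p w \<bullet> unit_dir \<theta>))) (at p)"
proof -
  have "((\<lambda>t. t * ln (1 + t\<^sup>2) + 2 * arctan t) has_real_derivative ln (1 + t\<^sup>2) + 2) (at t)" for t :: real
  proof -
    have pos: "0 < 1 + t\<^sup>2" by (simp add: add_pos_nonneg)
    then have "((\<lambda>t. t * ln (1 + t\<^sup>2) + 2 * arctan t) has_real_derivative
        ln (1 + t\<^sup>2) + 2 * (t * t / (1 + t\<^sup>2) + 1 / (1 + t\<^sup>2))) (at t)"
      by (auto intro!: derivative_eq_intros simp: inverse_eq_divide)
    moreover have "t * t / (1 + t\<^sup>2) + 1 / (1 + t\<^sup>2) = 1"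
      using pos by (simp add: power2_eq_square add.commute flip: add_divide_distrib)
    ultimately show ?thesis by simp
  qed
  from has_derivative_compose[OF slope_has_derivative this[unfolded has_field_derivative_def]]
  show ?thesis unfolding potential_across_def[abs_def] .
qed

text \<open>The two logarithmic terms cancel because mixed second derivatives agree.\<close>

lemma principal_defect_eq_divergence:
  "principal_defect \<theta> p =
     dir_deriv (potential_along \<theta>) (unit_dir \<theta>) p
     + dir_deriv (potential_across \<theta>) (unit_dir (\<theta> + pi / 2)) p"
  unfolding dir_deriv_eq[OF potential_along_has_derivative] dir_deriv_eq[OF potential_across_has_derivative]
  using bend_commute[of "\<theta> + pi / 2" \<theta> p]
  by (simp add: principal_defect_def bend_def algebra_simps)

text \<open>Both components vanish at least linearly with the gradient. This is what makes their flux through a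
  large circle small, as the gradient decays faster than the length of the circle grows.\<close>

lemma potential_bounds:
  assumes "norm (grad f p) \<le> m" "m \<le> 1"
  shows "\<bar>potential_along \<theta> p\<bar> \<le> m" "\<bar>potential_across \<theta> p\<bar> \<le> 3 * m"
proof -
  have slope: "\<bar>slope \<alpha> p\<bar> \<le> m" for \<alpha>
    using Cauchy_Schwarz_ineq2[of "grad f p" "unit_dir \<alpha>"] assms(1) by (simp add: slope_def)
  then have "(slope \<theta> p)\<^sup>2 \<le> 1"
    using assms(2) by (meson abs_square_le_1 order_trans)
  moreover have "0 \<le> ln (1 + (slope \<theta> p)\<^sup>2)"
    by simp
  moreover have "ln (1 + (slope \<theta> p)\<^sup>2) \<le> (slope \<theta> p)\<^sup>2"
    by (rule ln_add_one_self_le_self) simp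
  ultimately have log: "\<bar>ln (1 + (slope \<theta> p)\<^sup>2)\<bar> \<le> 1"
    by simp
  have product: "\<bar>slope \<alpha> p * ln (1 + (slope \<theta> p)\<^sup>2)\<bar> \<le> m * 1" for \<alpha>
    unfolding abs_mult using slope log by (intro mult_mono) (auto intro: order_trans[OF abs_ge_zero slope])
  then show "\<bar>potential_along \<theta> p\<bar> \<le> m"
    by (simp add: potential_along_def)
  have "\<bar>arctan (slope \<theta> p)\<bar> \<le> m"
    using abs_arctan_le slope by (rule order_trans)
  with product[of \<theta>] show "\<bar>potential_across \<theta> p\<bar> \<le> 3 * m"
    unfolding potential_across_def by linarith
qed

lemma disc_integral_principal_defect_bound:
  assumes "0 \<le> r" "0 \<le> m" "m \<le> 1" and grad_le: "\<And>p. norm p = r \<Longrightarrow> norm (grad f p) \<le> m"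
  shows "\<bar>LINT p:cball 0 r|lborel. principal_defect \<theta> p\<bar> \<le> 32 * (r * m)"
proof -
  let ?X = "unit_dir \<theta>" and ?Y = "unit_dir (\<theta> + pi / 2)"
  let ?P = "potential_along \<theta>" and ?Q = "potential_across \<theta>"
  note P = potential_along_has_derivative and Q = potential_across_has_derivative
  have P': "(?P has_derivative (\<lambda>w. dir_deriv ?P w p)) (at p)"
    and Q': "(?Q has_derivative (\<lambda>w. dir_deriv ?Q w p)) (at p)" for p
    using P Q unfolding dir_deriv_eq[OF P] dir_deriv_eq[OF Q] by blast+
  have contP: "continuous_on S (dir_deriv ?P w)" and contQ: "continuous_on S (dir_deriv ?Q w)" for S w
    unfolding dir_deriv_eq[OF P, abs_def] dir_deriv_eq[OF Q, abs_def]
    by (auto intro!: continuous_intros continuous_on_subset[OF hess_continuous] simp: order_less_imp_not_eq2[OF one_plus_slope_pos])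
  have int: "set_integrable lborel (cball 0 r) (dir_deriv ?P ?X)" "set_integrable lborel (cball 0 r) (dir_deriv ?Q ?Y)"
    unfolding set_integrable_def by (intro borel_integrable_compact compact_cball contP contQ)+
  have "(LINT p:cball 0 r|lborel. principal_defect \<theta> p) =
      (LINT p:cball 0 r|lborel. dir_deriv ?P ?X p) + (LINT p:cball 0 r|lborel. dir_deriv ?Q ?Y p)"
    unfolding principal_defect_eq_divergence by (rule set_integral_add(2)[OF int])
  moreover have "\<bar>LINT p:cball 0 r|lborel. dir_deriv ?P ?X p\<bar> \<le> 8 * r * m * norm ?X"
    using assms by (intro integral_directional_derivative_disc_bound[OF P' contP] potential_bounds grad_le)
  moreover have "\<bar>LINT p:cball 0 r|lborel. dir_deriv ?Q ?Y p\<bar> \<le> 8 * r * (3 * m) * norm ?Y"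
    using assms by (intro integral_directional_derivative_disc_bound[OF Q' contQ] potential_bounds grad_le) auto
  ultimately show ?thesis by simp
qed

lemma disc_integral_principal_defect_tendsto_0:
  assumes "asymptotically_constant f"
  shows "((\<lambda>r. LINT p:cball 0 r|lborel. principal_defect \<theta> p) \<longlongrightarrow> 0) at_top"
proof (rule tendstoI)
  fix e :: real assume "0 < e"
  (* Capped at 1 so that the potential bounds apply once r is at least 1. *)
  define \<epsilon> where "\<epsilon> = min 1 (e / 64)"
  have "0 < \<epsilon>" "\<epsilon> \<le> 1" "32 * \<epsilon> < e" using \<open>0 < e\<close> by (auto simp: \<epsilon>_def)
  have "\<forall>\<^sub>F r in at_top. \<forall>\<alpha>\<in>UNIV. dist (r * norm (grad f (r *\<^sub>R unit_dir \<alpha>))) 0 < \<epsilon>"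
    using assms \<open>0 < \<epsilon>\<close> unfolding asymptotically_constant_def uniform_limit_iff by blast
  then show "\<forall>\<^sub>F r in at_top. dist (LINT p:cball 0 r|lborel. principal_defect \<theta> p) 0 < e"
    using eventually_ge_at_top[of 1]
  proof eventually_elim
    case (elim r)
    have "norm (grad f p) \<le> \<epsilon> / r" if norm_p: "norm p = r" for p
    proof -
      obtain \<alpha> where "p = r *\<^sub>R unit_dir \<alpha>" using polar_representation[of p] unfolding norm_p by blast
      with elim show ?thesis by (auto simp: field_simps dist_real_def intro: less_imp_le dest: spec[of _ \<alpha>])
    qed
    moreover have "\<epsilon> / r \<le> 1" using elim \<open>\<epsilon> \<le> 1\<close> by (simp add: field_simps)
    ultimately have "\<bar>LINT p:cball 0 r|lborel. principal_defect \<theta> p\<bar> \<le> 32 * (r * (\<epsilon> / r))"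
      using elim \<open>0 < \<epsilon>\<close> by (intro disc_integral_principal_defect_bound) auto
    also have "32 * (r * (\<epsilon> / r)) = 32 * \<epsilon>"
      using elim by simp
    finally show ?case
      using \<open>32 * \<epsilon> < e\<close> by simp
  qed
qed

end

section \<open>Principal directions of asymptotically constant functions\<close>

text \<open>The curvature integrand is the principal defect, whose zeros are the points where the given direction
  is principal, so the separation claim is the statement about zero sets applied to the limit.\<close>

theorem theorem1p3:
  fixes f :: "real^2 \<Rightarrow> real" and \<theta>\<^sub>0 :: real
  assumes "C2 f" and "asymptotically_constant f"
  shows "((\<lambda>r. LINT p:cball 0 r|lborel.
             normal_curvature_deriv f p \<theta>\<^sub>0 * (1 + (dir_deriv f (unit_dir \<theta>\<^sub>0) p)\<^sup>2) * area_density f p)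
           \<longlongrightarrow> 0) at_top \<and>
         ({p. principal_direction f p (unit_dir \<theta>\<^sub>0)} = UNIV \<or>
          separates {p. principal_direction f p (unit_dir \<theta>\<^sub>0)})"
proof -
  obtain H where "hessian f H"
    using C2_imp_hessian[OF assms(1)] by blast
  then interpret hessian f H .
  have "((\<lambda>r. LINT p:cball 0 r|lborel. principal_defect \<theta>\<^sub>0 p) \<longlongrightarrow> 0) at_top"
    using assms(2) by (rule disc_integral_principal_defect_tendsto_0)
  then show ?thesis
    using lim_disc_integrals_zero_imp_zero_set_separates[OF continuous_on_principal_defect]
    unfolding curvature_integrand_eq_principal_defect principal_direction_iff separates_def by blast
qed

end
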